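(* Let $E$ be an atomic Banach lattice with order continuous norm, and let $T:E\to E$ be an operator. Then the following assertions are equivalent: (1) $T$ is uo-demi Dunford–Pettis. (2) For every weak Cauchy sequence $(x_n)$ in $E$ such that every subsequence of the sequence $(x_n-T(x_n))$ is uo-null, the sequence $(x_n)$ is norm convergent.
   Context: All Banach lattices are real; "operator" means bounded linear map. A net $(x_\alpha)$ in a Banach lattice $E$ is uo-convergent (unbounded order convergent) to $x$, written $x_\alpha\xrightarrow{uo}x$, if $|x_\alpha-x|\wedge y$ converges in order to $0$ for every $y\in E^+$; it is uo-null if $x_\alpha\xrightarrow{uo}0$. An operator $T:E\to E$ on a Banach lattice $E$ is uo-demi Dunford–Pettis (unbounded order demi Dunford–Pettis) if for every weakly null sequence $(x_n)$ in $E$ such that $(x_n-T(x_n))$ is uo-convergent to $0$, one has $\|x_n\|\to0$. A nonzero element $x$ of a vector lattice is an atom (discrete element) if the order ideal generated by $x$ equals the vector subspace generated by $x$; a vector lattice is atomic (discrete) if it admits a complete disjoint system of atoms. A norm is order continuous if $x_\alpha\downarrow0$ implies $\|x_\alpha\|\to0$. *)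

theory Defs
  imports "HOL-Analysis.Analysis" "HOL-Library.Lattice_Algebras" "HOL-Library.Lub_Glb"
begin

class vector_lattice = ordered_real_vector + lattice_ab_group_add_abs

class banach_lattice = banach + vector_lattice +
  assumes norm_mono_abs: "\<bar>x\<bar> \<le> \<bar>y\<bar> \<Longrightarrow> norm x \<le> norm y"

instance real :: banach_lattice
  by standard simp


(* D, regarded as a net indexed by itself with the reversed order, decreases to 0.
   A decreasing net and its range have the same lower bounds, and its range is downward
   directed, so ranging over such sets D is the same as ranging over all nets that decrease to 0. *)
definition decreases_to_zero :: "'a::vector_lattice set \<Rightarrow> bool" where
  "decreases_to_zero D \<longleftrightarrow>
     D \<noteq> {} \<and> (\<forall>a\<in>D. \<forall>b\<in>D. \<exists>c\<in>D. c \<le> a \<and> c \<le> b) \<and> isGlb UNIV D 0"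

lemma decreases_to_zero_net:
  fixes x :: "'i \<Rightarrow> 'a::vector_lattice"
  assumes "I \<noteq> {}" and "\<And>i j. i \<in> I \<Longrightarrow> j \<in> I \<Longrightarrow> \<exists>k\<in>I. le i k \<and> le j k"
    and "\<And>i j. i \<in> I \<Longrightarrow> j \<in> I \<Longrightarrow> le i j \<Longrightarrow> x j \<le> x i"
    and "isGlb UNIV (x ` I) 0"
  shows "decreases_to_zero (x ` I)"
  unfolding decreases_to_zero_def using assms by (simp, meson)

definition order_continuous_norm :: "'a::banach_lattice itself \<Rightarrow> bool" where
  "order_continuous_norm TYPE('a) \<longleftrightarrow>
     (\<forall>D::'a set. decreases_to_zero D \<longrightarrow>
        (\<forall>\<epsilon>>0. \<exists>d\<in>D. \<forall>x\<in>D. x \<le> d \<longrightarrow> norm x < \<epsilon>))"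

(* Nets are given by their eventuality filter F. The dominating net that decreases to 0 may be
   indexed differently from x, so that only tails of x have to be order bounded. *)
definition order_converges :: "('i \<Rightarrow> 'a::vector_lattice) \<Rightarrow> 'a \<Rightarrow> 'i filter \<Rightarrow> bool" where
  "order_converges x l F \<longleftrightarrow>
     (\<exists>D. decreases_to_zero D \<and> (\<forall>d\<in>D. eventually (\<lambda>i. \<bar>x i - l\<bar> \<le> d) F))"

definition uo_converges :: "('i \<Rightarrow> 'a::vector_lattice) \<Rightarrow> 'a \<Rightarrow> 'i filter \<Rightarrow> bool" where
  "uo_converges x l F \<longleftrightarrow> (\<forall>y\<ge>0. order_converges (\<lambda>i. inf \<bar>x i - l\<bar> y) 0 F)"

abbreviation uo_null :: "(nat \<Rightarrow> 'a::vector_lattice) \<Rightarrow> bool" where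
  "uo_null x \<equiv> uo_converges x 0 sequentially"


definition order_ideal :: "'a::vector_lattice set \<Rightarrow> bool" where
  "order_ideal I \<longleftrightarrow> subspace I \<and> (\<forall>x\<in>I. \<forall>y. \<bar>y\<bar> \<le> \<bar>x\<bar> \<longrightarrow> y \<in> I)"

definition lattice_atom :: "'a::vector_lattice \<Rightarrow> bool" where
  "lattice_atom x \<longleftrightarrow> x \<noteq> 0 \<and> order_ideal hull {x} = span {x}"

definition lattice_disjoint :: "'a::vector_lattice \<Rightarrow> 'a \<Rightarrow> bool" where
  "lattice_disjoint x y \<longleftrightarrow> inf \<bar>x\<bar> \<bar>y\<bar> = 0"

(* A disjoint system is complete if only 0 is disjoint from all of its elements. *)
definition atomic_vector_lattice :: "'a::vector_lattice itself \<Rightarrow> bool" where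
  "atomic_vector_lattice TYPE('a) \<longleftrightarrow>
     (\<exists>A::'a set. (\<forall>a\<in>A. lattice_atom a) \<and> pairwise lattice_disjoint A \<and>
        (\<forall>x. (\<forall>a\<in>A. lattice_disjoint x a) \<longrightarrow> x = 0))"


definition weakly_null :: "(nat \<Rightarrow> 'a::real_normed_vector) \<Rightarrow> bool" where
  "weakly_null x \<longleftrightarrow> (\<forall>f::'a \<Rightarrow> real. bounded_linear f \<longrightarrow> (\<lambda>n. f (x n)) \<longlonglongrightarrow> 0)"

definition weakly_Cauchy :: "(nat \<Rightarrow> 'a::real_normed_vector) \<Rightarrow> bool" where
  "weakly_Cauchy x \<longleftrightarrow> (\<forall>f::'a \<Rightarrow> real. bounded_linear f \<longrightarrow> Cauchy (\<lambda>n. f (x n)))"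

definition uo_demi_Dunford_Pettis :: "('a::banach_lattice \<Rightarrow> 'a) \<Rightarrow> bool" where
  "uo_demi_Dunford_Pettis T \<longleftrightarrow>
     bounded_linear T \<and>
     (\<forall>x. weakly_null x \<longrightarrow> uo_null (\<lambda>n. x n - T (x n)) \<longrightarrow> (\<lambda>n. norm (x n)) \<longlonglongrightarrow> 0)"

end

theory Submission
  imports Defs
begin

text \<open>Uo-limits of nets are compatible with subtraction and with passing to subnets. If a weakly
  Cauchy sequence is not norm Cauchy, differences of its terms along two subsequences form a weakly
  null sequence that stays away from 0. Conversely, a weakly null sequence interleaved with zeros is
  still weakly Cauchy, and its only possible norm limit is 0.\<close>

lemma isGlb_UNIV_iff: "isGlb UNIV D l \<longleftrightarrow> (\<forall>d\<in>D. l \<le> d) \<and> (\<forall>m. (\<forall>d\<in>D. m \<le> d) \<longrightarrow> m \<le> l)"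
  by (auto simp: isGlb_def greatestP_def isLb_def setge_def setle_def)

lemma decreases_to_zero_nonneg: "decreases_to_zero D \<Longrightarrow> d \<in> D \<Longrightarrow> 0 \<le> d"
  by (simp add: decreases_to_zero_def isGlb_UNIV_iff)

text \<open>If \<open>m\<close> is below every sum, then for fixed \<open>d\<close> the element
  \<open>m - d\<close> is a lower bound of \<open>E\<close>, hence \<open>m - d \<le> 0\<close>. So
  \<open>m\<close> is a lower bound of \<open>D\<close>, which gives
  \<open>m \<le> 0\<close>.\<close>

lemma decreases_to_zero_add:
  fixes D E :: "'a::vector_lattice set"
  assumes D: "decreases_to_zero D" and E: "decreases_to_zero E"
  shows "decreases_to_zero {d + e |d e. d \<in> D \<and> e \<in> E}" (is "decreases_to_zero ?S")
  unfolding decreases_to_zero_def isGlb_UNIV_iff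
proof (intro conjI ballI allI impI)
  show "?S \<noteq> {}"
    using D E by (auto simp: decreases_to_zero_def)
next
  fix a b assume "a \<in> ?S" "b \<in> ?S"
  then obtain d e d' e' where ab: "a = d + e" "b = d' + e'" "d \<in> D" "e \<in> E" "d' \<in> D" "e' \<in> E"
    by blast
  obtain d'' where "d'' \<in> D" "d'' \<le> d" "d'' \<le> d'"
    using D ab unfolding decreases_to_zero_def by blast
  moreover obtain e'' where "e'' \<in> E" "e'' \<le> e" "e'' \<le> e'"
    using E ab unfolding decreases_to_zero_def by blast
  ultimately show "\<exists>c\<in>?S. c \<le> a \<and> c \<le> b"
    unfolding ab by (intro bexI[of _ "d'' + e''"]) (auto intro: add_mono)
next
  fix s assume "s \<in> ?S"
  then show "0 \<le> s"
    using decreases_to_zero_nonneg[OF D] decreases_to_zero_nonneg[OF E] by auto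
next
  fix m assume m: "\<forall>s\<in>?S. m \<le> s"
  have "m \<le> d" if d: "d \<in> D" for d
  proof -
    have "\<forall>e\<in>E. m - d \<le> e"
      using m d by (auto simp: diff_le_eq add.commute[of _ d])
    then have "m - d \<le> 0"
      using E unfolding decreases_to_zero_def isGlb_UNIV_iff by blast
    then show ?thesis by simp
  qed
  then show "m \<le> 0"
    using D by (simp add: decreases_to_zero_def isGlb_UNIV_iff)
qed

text \<open>By distributivity of addition over \<open>inf\<close>, the right side is the infimum of
  the four sums \<open>\<bar>a\<bar> + \<bar>b\<bar>\<close>, \<open>\<bar>a\<bar> + y\<close>,
  \<open>y + \<bar>b\<bar>\<close> and \<open>y + y\<close>. The first dominates the left side by
  the triangle inequality, the others because they are at least \<open>y\<close>.\<close>

lemma inf_abs_diff_le: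
  fixes a b y :: "'a::vector_lattice"
  assumes "0 \<le> y"
  shows "inf \<bar>a - b\<bar> y \<le> inf \<bar>a\<bar> y + inf \<bar>b\<bar> y"
proof -
  have "inf \<bar>a - b\<bar> y \<le> \<bar>a\<bar> + \<bar>b\<bar>"
    by (rule order_trans[OF inf_le1 abs_triangle_ineq4])
  moreover have "inf \<bar>a - b\<bar> y \<le> \<bar>a\<bar> + y"
    by (rule order_trans[OF inf_le2]) simp
  moreover have "inf \<bar>a - b\<bar> y \<le> y + \<bar>b\<bar>"
    by (rule order_trans[OF inf_le2]) simp
  moreover have "inf \<bar>a - b\<bar> y \<le> y + y"
    by (rule order_trans[OF inf_le2]) (use assms in simp)
  ultimately show ?thesis
    by (simp add: add_inf_distrib_left add_inf_distrib_right)
qed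

text \<open>Since \<open>0 \<le> y\<close>, the infimum is nonnegative, so the outer absolute value
  coming from order convergence to 0 disappears.\<close>

lemma uo_converges_iff:
  "uo_converges x l F \<longleftrightarrow>
    (\<forall>y\<ge>0. \<exists>D. decreases_to_zero D \<and> (\<forall>d\<in>D. eventually (\<lambda>i. inf \<bar>x i - l\<bar> y \<le> d) F))"
  by (simp add: uo_converges_def order_converges_def)

text \<open>The dominating set stays the same; only the eventualities are pulled back along
  \<open>g\<close>. Monotonicity of \<open>g\<close> is not asked for, so the lemma covers
  subsequences as well as arbitrary index maps tending to infinity.\<close>

lemma uo_converges_compose:
  assumes "uo_converges x l F" and "filterlim g F G"
  shows "uo_converges (\<lambda>i. x (g i)) l G"
  using assms(1) eventually_compose_filterlim[OF _ assms(2)] unfolding uo_converges_iff by meson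

lemma uo_converges_diff:
  fixes x z :: "'i \<Rightarrow> 'a::vector_lattice"
  assumes x: "uo_converges x l F" and z: "uo_converges z m F"
  shows "uo_converges (\<lambda>i. x i - z i) (l - m) F"
  unfolding uo_converges_iff
proof (intro allI impI)
  fix y :: 'a assume y: "0 \<le> y"
  obtain D where D: "decreases_to_zero D" "\<forall>d\<in>D. eventually (\<lambda>i. inf \<bar>x i - l\<bar> y \<le> d) F"
    using x y unfolding uo_converges_iff by blast
  obtain E where E: "decreases_to_zero E" "\<forall>e\<in>E. eventually (\<lambda>i. inf \<bar>z i - m\<bar> y \<le> e) F"
    using z y unfolding uo_converges_iff by blast
  have "eventually (\<lambda>i. inf \<bar>x i - z i - (l - m)\<bar> y \<le> d + e) F" if "d \<in> D" "e \<in> E" for d e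
    using D(2)[rule_format, OF that(1)] E(2)[rule_format, OF that(2)]
  proof eventually_elim
    case (elim i)
    have "x i - z i - (l - m) = (x i - l) - (z i - m)"
      by (simp add: algebra_simps)
    then show ?case
      using inf_abs_diff_le[OF y, of "x i - l" "z i - m"] add_mono[OF elim] by (metis order_trans)
  qed
  then show "\<exists>D. decreases_to_zero D \<and>
      (\<forall>d\<in>D. eventually (\<lambda>i. inf \<bar>x i - z i - (l - m)\<bar> y \<le> d) F)"
    by (intro exI[of _ "{d + e |d e. d \<in> D \<and> e \<in> E}"] conjI decreases_to_zero_add D(1) E(1)) auto
qed

text \<open>The dominating set for \<open>w\<close> still works: at even indices its bounds are
  pulled back along \<open>n div 2\<close>, and an inserted zero contributes
  \<open>inf 0 y = 0\<close>, which is below every element of the set.\<close>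

lemma uo_null_interleave_zero:
  fixes w :: "nat \<Rightarrow> 'a::vector_lattice"
  assumes "uo_null w"
  shows "uo_null (\<lambda>n. if even n then w (n div 2) else 0)"
  unfolding uo_converges_iff
proof (intro allI impI)
  fix y :: 'a assume y: "0 \<le> y"
  obtain D where D: "decreases_to_zero D"
      "\<forall>d\<in>D. eventually (\<lambda>n. inf \<bar>w n - 0\<bar> y \<le> d) sequentially"
    using assms y unfolding uo_converges_iff by blast
  have half: "filterlim (\<lambda>n::nat. n div 2) sequentially sequentially"
    by (rule filterlim_at_top_div_const_nat) simp
  have "eventually (\<lambda>n. inf \<bar>(if even n then w (n div 2) else 0) - 0\<bar> y \<le> d) sequentially"
    if d: "d \<in> D" for d
    using eventually_compose_filterlim[OF D(2)[rule_format, OF d] half]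
    by eventually_elim (use y decreases_to_zero_nonneg[OF D(1) d] in \<open>auto simp: inf_absorb1\<close>)
  with D(1) show "\<exists>D. decreases_to_zero D \<and> (\<forall>d\<in>D.
      eventually (\<lambda>n. inf \<bar>(if even n then w (n div 2) else 0) - 0\<bar> y \<le> d) sequentially)"
    by blast
qed

lemma tendsto_interleave_zero:
  fixes w :: "nat \<Rightarrow> 'a::real_normed_vector"
  assumes "w \<longlonglongrightarrow> 0"
  shows "(\<lambda>n. if even n then w (n div 2) else 0) \<longlonglongrightarrow> 0"
proof -
  have "filterlim (\<lambda>n::nat. n div 2) sequentially sequentially"
    by (rule filterlim_at_top_div_const_nat) simp
  then have "(\<lambda>n. w (n div 2)) \<longlonglongrightarrow> 0"
    by (rule filterlim_compose[OF assms])
  then show ?thesis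
    by (rule tendsto_0_le[where K = 1]) auto
qed

text \<open>For each functional \<open>f\<close>, completeness of the reals gives
  \<open>f (x n)\<close> a limit \<open>c\<close>. Both reindexed sequences share this limit, so it
  cancels, even if \<open>x\<close> has no weak limit.\<close>

lemma weakly_Cauchy_diff_weakly_null:
  fixes x :: "nat \<Rightarrow> 'a::real_normed_vector"
  assumes x: "weakly_Cauchy x"
    and p: "filterlim p sequentially sequentially" and q: "filterlim q sequentially sequentially"
  shows "weakly_null (\<lambda>k. x (p k) - x (q k))"
  unfolding weakly_null_def
proof (intro allI impI)
  fix f :: "'a \<Rightarrow> real" assume f: "bounded_linear f"
  obtain c where c: "(\<lambda>n. f (x n)) \<longlonglongrightarrow> c"
    using x f unfolding weakly_Cauchy_def Cauchy_convergent_iff convergent_def by blast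
  have "(\<lambda>k. f (x (p k)) - f (x (q k))) \<longlonglongrightarrow> c - c"
    by (intro tendsto_diff filterlim_compose[OF c] p q)
  then show "(\<lambda>k. f (x (p k) - x (q k))) \<longlonglongrightarrow> 0"
    by (simp add: bounded_linear.linear[OF f] linear_diff)
qed

lemma uo_demi_Dunford_Pettis_convergent:
  fixes T :: "'a::banach_lattice \<Rightarrow> 'a"
  assumes T: "uo_demi_Dunford_Pettis T" and x: "weakly_Cauchy x"
    and uo: "uo_null (\<lambda>k. x k - T (x k))"
  shows "convergent x"
proof -
  have lin: "linear T"
    using T by (simp add: uo_demi_Dunford_Pettis_def bounded_linear.linear)
  have "Cauchy x"
  proof (rule ccontr)
    assume "\<not> Cauchy x"
    then obtain e where e: "e > 0" and "\<forall>M. \<exists>m n. m \<ge> M \<and> n \<ge> M \<and> dist (x m) (x n) \<ge> e"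
      unfolding Cauchy_def by (meson not_less)
    \<comment> \<open>The choice functions need not be increasing, but \<open>p M \<ge> M\<close>
      and \<open>q M \<ge> M\<close> already force them to tend to infinity.\<close>
    then obtain p q where pq: "\<And>M. p M \<ge> M" "\<And>M. q M \<ge> M" "\<And>M. dist (x (p M)) (x (q M)) \<ge> e"
      by metis
    have p: "filterlim p sequentially sequentially" and q: "filterlim q sequentially sequentially"
      by (rule filterlim_at_top_mono[OF filterlim_ident], simp add: pq)+
    let ?z = "\<lambda>k. x (p k) - x (q k)"
    have "uo_null (\<lambda>k. (x (p k) - T (x (p k))) - (x (q k) - T (x (q k))))"
      using uo_converges_diff[OF uo_converges_compose[OF uo p] uo_converges_compose[OF uo q]]
      by simp
    \<comment> \<open>By linearity of \<open>T\<close>, subtracting the residuals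
      \<open>x - T x\<close> along \<open>p\<close> and \<open>q\<close> yields the residual of the
      difference.\<close>
    then have "uo_null (\<lambda>k. ?z k - T (?z k))"
      by (simp add: linear_diff[OF lin] algebra_simps)
    then have "(\<lambda>k. norm (?z k)) \<longlonglongrightarrow> 0"
      using T weakly_Cauchy_diff_weakly_null[OF x p q] unfolding uo_demi_Dunford_Pettis_def by blast
    then have "eventually (\<lambda>k. norm (?z k) < e) sequentially"
      using e by (rule order_tendstoD)
    then show False
      using pq(3) by (auto simp: dist_norm not_less[symmetric])
  qed
  then show ?thesis
    by (rule Cauchy_convergent)
qed

theorem proposition2p4:
  fixes T :: "'a::banach_lattice \<Rightarrow> 'a"
  assumes "atomic_vector_lattice TYPE('a)"
    and "order_continuous_norm TYPE('a)"
    and "bounded_linear T"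
  shows "uo_demi_Dunford_Pettis T \<longleftrightarrow>
    (\<forall>x::nat \<Rightarrow> 'a.
      weakly_Cauchy x \<longrightarrow>
      (\<forall>r. strict_mono r \<longrightarrow> uo_null (\<lambda>k. x (r k) - T (x (r k)))) \<longrightarrow>
      convergent x)"
proof (intro iffI allI impI)
  fix x :: "nat \<Rightarrow> 'a"
  assume "uo_demi_Dunford_Pettis T" "weakly_Cauchy x"
    and "\<forall>r. strict_mono r \<longrightarrow> uo_null (\<lambda>k. x (r k) - T (x (r k)))"
  then show "convergent x"
    \<comment> \<open>The choice of \<open>r\<close> as the identity makes the whole residual
      sequence uo-null.\<close>
    using strict_mono_id by (intro uo_demi_Dunford_Pettis_convergent) (auto simp: id_def)
next
  assume conv: "\<forall>x::nat \<Rightarrow> 'a. weakly_Cauchy x \<longrightarrow>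
      (\<forall>r. strict_mono r \<longrightarrow> uo_null (\<lambda>k. x (r k) - T (x (r k)))) \<longrightarrow> convergent x"
  show "uo_demi_Dunford_Pettis T"
    unfolding uo_demi_Dunford_Pettis_def
  proof (intro conjI allI impI assms(3))
    fix x :: "nat \<Rightarrow> 'a"
    assume x: "weakly_null x" and uo: "uo_null (\<lambda>n. x n - T (x n))"
    let ?y = "\<lambda>n. if even n then x (n div 2) else 0"
    have "weakly_Cauchy ?y"
      unfolding weakly_Cauchy_def
    proof (intro allI impI)
      fix f :: "'a \<Rightarrow> real" assume f: "bounded_linear f"
      then have "(\<lambda>n. if even n then f (x (n div 2)) else 0) \<longlonglongrightarrow> 0"
        using x by (intro tendsto_interleave_zero) (simp add: weakly_null_def)
      moreover have "(\<lambda>n. if even n then f (x (n div 2)) else 0) = (\<lambda>n. f (?y n))"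
        using linear_0[OF bounded_linear.linear[OF f]] by auto
      ultimately show "Cauchy (\<lambda>n. f (?y n))"
        by (metis LIMSEQ_imp_Cauchy)
    qed
    moreover have "uo_null (\<lambda>k. ?y (r k) - T (?y (r k)))" if "strict_mono r" for r
    proof -
      \<comment> \<open>Because \<open>T 0 = 0\<close>, interleaving with zeros commutes with
        forming residuals.\<close>
      have "(\<lambda>n. if even n then x (n div 2) - T (x (n div 2)) else 0) = (\<lambda>n. ?y n - T (?y n))"
        using linear_0[OF bounded_linear.linear[OF assms(3)]] by auto
      then have "uo_null (\<lambda>n. ?y n - T (?y n))"
        using uo_null_interleave_zero[OF uo] by simp
      then show ?thesis
        by (rule uo_converges_compose) (rule filterlim_subseq[OF that])
    qed
    ultimately obtain l where l: "?y \<longlonglongrightarrow> l"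
      using conv unfolding convergent_def by blast
    \<comment> \<open>Along odd indices \<open>?y\<close> is constantly 0, which fixes the limit;
      along even indices it is \<open>x\<close> itself, so \<open>x\<close> inherits that
      limit.\<close>
    have "(\<lambda>n. ?y (2 * n + 1)) \<longlonglongrightarrow> l"
      by (rule filterlim_compose[OF l filterlim_subseq]) (simp add: strict_mono_def)
    then have "l = 0"
      by (simp add: LIMSEQ_const_iff)
    moreover have "(\<lambda>n. ?y (2 * n)) \<longlonglongrightarrow> l"
      by (rule filterlim_compose[OF l filterlim_subseq]) (simp add: strict_mono_def)
    ultimately show "(\<lambda>n. norm (x n)) \<longlonglongrightarrow> 0"
      by (simp add: tendsto_norm_zero_iff)
  qed
qed

end
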